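(* Let $m \geq 1$ be an integer, $\zeta = e^{2\pi i/m}$, and let $G = G(m,1,2) \subset GL(2,\mathbb{C})$ be the group of all $2\times 2$ complex matrices of the form \[ \begin{pmatrix} \zeta^j & 0 \\ 0 & \zeta^k \end{pmatrix}, \qquad \begin{pmatrix} 0 & \zeta^k \\ \zeta^j & 0 \end{pmatrix}, \qquad j,k \in \mathbb{Z}/m\mathbb{Z}. \] Identify $\mathbb{C}^2$ with $\mathbb{R}^4$ (using the $\mathbb{R}$-basis $1,i$ of $\mathbb{C}$ in each coordinate), so that $G$ becomes a finite subgroup of the orthogonal group $O_4(\mathbb{R})$. Then there exists $M$ such that for every $m \geq M$, $G$ is a rotation group and the subspace arrangement $\mathcal{A}^G$ is not contained in $\mathcal{A}^W$ for any finite real reflection group $W \subset O_4(\mathbb{R})$.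
   Context: For a finite-dimensional real vector space $V$ and a finite subgroup $G \subset GL(V)$: an element $g \in G$ is a reflection if its $1$-eigenspace (fixed subspace) has codimension one, and a rotation if its $1$-eigenspace has codimension exactly two. $G$ is a (real) reflection group if it is generated by its reflections, and a rotation group if it is generated by its rotations. For a subgroup $H \subset G$, $V^H = \{v \in V : hv = v \ \forall h \in H\}$. An isotropy subgroup is the stabilizer $\{g \in G : gv = v\}$ of some vector $v \in V$. The subspace arrangement of $G$ is $\mathcal{A}^G = \{V^H : H \neq \{e\} \text{ is an isotropy subgroup of } G\}$, a collection of linear subspaces of $V$. *)

theory Defs
  imports "HOL-Analysis.Analysis" "HOL-Algebra.Generated_Groups"
begin

definition GL :: "('a::euclidean_space \<Rightarrow> 'a) monoid" where
  "GL = \<lparr>carrier = {f. linear f \<and> bij f}, mult = (\<circ>), one = id\<rparr>"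

lemma group_GL: "group (GL :: ('a::euclidean_space \<Rightarrow> 'a) monoid)"
proof (rule groupI)
  fix f :: "'a \<Rightarrow> 'a"
  assume "f \<in> carrier GL"
  then have f: "linear f" "bij f"
    by (auto simp: GL_def)
  have "linear (inv_into UNIV f)"
    using f by (simp add: bij_is_inj inj_linear_imp_inv_linear)
  with f show "\<exists>g\<in>carrier GL. g \<otimes>\<^bsub>GL\<^esub> f = \<one>\<^bsub>GL\<^esub>"
    by (auto simp: GL_def bij_imp_bij_inv bij_is_inj intro!: exI[of _ "inv_into UNIV f"])
qed (auto simp: GL_def linear_compose bij_comp linear_id o_assoc)

definition finite_linear_group :: "('a::euclidean_space \<Rightarrow> 'a) set \<Rightarrow> bool" where
  "finite_linear_group G \<longleftrightarrow> finite G \<and> subgroup G GL"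

definition fixed_space :: "('a::euclidean_space \<Rightarrow> 'a) set \<Rightarrow> 'a set" where
  "fixed_space H = {v. \<forall>h\<in>H. h v = v}"

definition is_reflection :: "('a::euclidean_space \<Rightarrow> 'a) \<Rightarrow> bool" where
  "is_reflection g \<longleftrightarrow> dim (fixed_space {g}) + 1 = DIM('a)"

definition is_rotation :: "('a::euclidean_space \<Rightarrow> 'a) \<Rightarrow> bool" where
  "is_rotation g \<longleftrightarrow> dim (fixed_space {g}) + 2 = DIM('a)"

definition reflection_group :: "('a::euclidean_space \<Rightarrow> 'a) set \<Rightarrow> bool" where
  "reflection_group G \<longleftrightarrow> finite_linear_group G \<and> generate GL {g \<in> G. is_reflection g} = G"

definition rotation_group :: "('a::euclidean_space \<Rightarrow> 'a) set \<Rightarrow> bool" where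
  "rotation_group G \<longleftrightarrow> finite_linear_group G \<and> generate GL {g \<in> G. is_rotation g} = G"

definition isotropy_subgroup :: "('a::euclidean_space \<Rightarrow> 'a) set \<Rightarrow> ('a \<Rightarrow> 'a) set \<Rightarrow> bool" where
  "isotropy_subgroup G H \<longleftrightarrow> (\<exists>v. H = {g \<in> G. g v = v})"

definition subspace_arrangement :: "('a::euclidean_space \<Rightarrow> 'a) set \<Rightarrow> 'a set set" where
  "subspace_arrangement G = {fixed_space H | H. isotropy_subgroup G H \<and> H \<noteq> {id}}"

definition orthogonal_group :: "('a::euclidean_space \<Rightarrow> 'a) set" where
  "orthogonal_group = {f. orthogonal_transformation f}"


definition G_m_1_2 :: "nat \<Rightarrow> (complex^2^2) set" where
  "G_m_1_2 m = (let \<zeta> = exp (2 * of_real pi * \<i> / of_nat m) in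
     {vector [vector [\<zeta> ^ j, 0], vector [0, \<zeta> ^ k]] | j k. j < m \<and> k < m} \<union>
     {vector [vector [0, \<zeta> ^ k], vector [\<zeta> ^ j, 0]] | j k. j < m \<and> k < m})"

definition to_R4 :: "complex^2 \<Rightarrow> real^4" where
  "to_R4 z = vector [Re (z $ 1), Im (z $ 1), Re (z $ 2), Im (z $ 2)]"

definition of_R4 :: "real^4 \<Rightarrow> complex^2" where
  "of_R4 x = vector [Complex (x $ 1) (x $ 2), Complex (x $ 3) (x $ 4)]"

definition realification :: "complex^2^2 \<Rightarrow> real^4 \<Rightarrow> real^4" where
  "realification A = (\<lambda>x. to_R4 (A *v of_R4 x))"

definition real_G_m_1_2 :: "nat \<Rightarrow> (real^4 \<Rightarrow> real^4) set" where
  "real_G_m_1_2 m = realification ` G_m_1_2 m"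

lemma to_R4_nth [simp]:
  "to_R4 z $ 1 = Re (z $ 1)" "to_R4 z $ 2 = Im (z $ 1)"
  "to_R4 z $ 3 = Re (z $ 2)" "to_R4 z $ 4 = Im (z $ 2)"
  by (simp_all add: to_R4_def vector_def)

lemma of_R4_nth [simp]:
  "of_R4 x $ 1 = Complex (x $ 1) (x $ 2)" "of_R4 x $ 2 = Complex (x $ 3) (x $ 4)"
  by (simp_all add: of_R4_def)

lemma of_R4_to_R4 [simp]: "of_R4 (to_R4 z) = z"
  by (simp add: vec_eq_iff forall_2)

lemma to_R4_of_R4 [simp]: "to_R4 (of_R4 x) = x"
  by (simp add: vec_eq_iff forall_4)

lemma norm_to_R4: "norm (to_R4 z) = norm z"
  by (simp add: norm_vec_def L2_set_def sum_2 sum_4 cmod_power2)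

lemma realification_in_orthogonal_group:
  assumes "A \<in> G_m_1_2 m"
  shows "realification A \<in> orthogonal_group"
proof -
  define \<zeta> :: complex where "\<zeta> = exp (2 * of_real pi * \<i> / of_nat m)"
  have "norm \<zeta> = 1"
    by (simp add: \<zeta>_def norm_exp_eq_Re)
  then have n: "norm (\<zeta> ^ j) = 1" for j
    by (simp add: norm_power)
  have lin: "linear (realification A)"
    by (rule linearI)
       (simp_all add: realification_def vec_eq_iff forall_4 matrix_vector_mult_def sum_2
          algebra_simps)
  have A: "norm (A *v z) = norm z" for z
    using assms unfolding G_m_1_2_def Let_def \<zeta>_def[symmetric]
    by (auto simp: norm_vec_def L2_set_def matrix_vector_mult_def sum_2 norm_mult n add.commute)
  have "norm (realification A x) = norm x" for x
    using A[of "of_R4 x"] norm_to_R4[of "A *v of_R4 x"] norm_to_R4[of "of_R4 x"]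
    by (simp add: realification_def)
  with lin show ?thesis
    by (simp add: orthogonal_group_def orthogonal_transformation)
qed

end

theory Submission
  imports Defs
begin

text \<open>
  Every plane of the arrangement of \<open>W\<close> is the orthogonal complement of a plane spanned by two
  roots of \<open>W\<close>, because a vector orthogonal to no root has trivial stabilizer. The arrangement of
  \<open>G(m,1,2)\<close> contains the complex lines \<open>z\<^sub>2 = 0\<close>, \<open>z\<^sub>1 = 0\<close> and \<open>z\<^sub>1 = u z\<^sub>2\<close> with \<open>u\<^sup>m = 1\<close>, so for
  large \<open>m\<close> the pigeonhole principle yields two distinct roots \<open>r\<close>, \<open>s\<close> at an angle less than
  \<open>\<pi>/6\<close>. Their product is a rotation of angle less than \<open>\<pi>/3\<close>, too small for a finite group unless
  every root lies in the plane \<open>Q = span {r, s}\<close> or in its orthogonal complement. Then \<open>Q\<close> meets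
  the orthogonal complements of all these complex lines. Meeting both coordinate axes makes \<open>Q\<close> a
  real span of \<open>(a, 0)\<close> and \<open>(0, b)\<close>, and such a plane meets the other lines only if all \<open>m\<close>-th
  roots of unity are real.
\<close>

section \<open>Finite groups generated by orthogonal reflections\<close>

text \<open>The usual division by \<open>r \<bullet> r\<close> is left out, so this is the
  orthogonal reflection in the hyperplane orthogonal to \<open>r\<close> when \<open>r\<close> is a
  unit vector.\<close>

definition reflect :: "'a::euclidean_space \<Rightarrow> 'a \<Rightarrow> 'a" where
  "reflect r x = x - (2 * (r \<bullet> x)) *\<^sub>R r"

text \<open>Unit length is the normalisation: each orthogonal reflection in \<open>W\<close> has
  exactly two roots, \<open>r\<close> and \<open>- r\<close>.\<close>

definition roots :: "('a::euclidean_space \<Rightarrow> 'a) set \<Rightarrow> 'a set" where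
  "roots W = {r. norm r = 1 \<and> reflect r \<in> W}"

definition word :: "'a::euclidean_space list \<Rightarrow> 'a \<Rightarrow> 'a" where
  "word rs = foldr (\<lambda>r f. reflect r \<circ> f) rs id"

lemma word_simps [simp]: "word [] = id" "word (r # rs) = reflect r \<circ> word rs"
  by (simp_all add: word_def)

lemma word_append: "word (rs @ ss) = word rs \<circ> word ss"
  by (induction rs) (simp_all add: o_assoc)

lemma reflect_minus [simp]: "reflect (- r) = reflect r"
  by (simp add: reflect_def fun_eq_iff)

lemma reflect_self: "norm r = 1 \<Longrightarrow> reflect r r = - r"
  by (simp add: reflect_def dot_square_norm scaleR_2)

lemma reflect_fixes: "r \<bullet> x = 0 \<Longrightarrow> reflect r x = x"
  by (simp add: reflect_def)

lemma reflect_eq_self_iff: "norm r = 1 \<Longrightarrow> reflect r x = x \<longleftrightarrow> r \<bullet> x = 0"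
  by (auto simp: reflect_def)

lemma reflect_reflect: "norm r = 1 \<Longrightarrow> reflect r (reflect r x) = x"
  by (simp add: reflect_def inner_diff_right dot_square_norm)

lemma reflect_comp_reflect: "norm r = 1 \<Longrightarrow> reflect r \<circ> reflect r = id"
  by (simp add: fun_eq_iff reflect_reflect)

lemma inner_reflect_left: "reflect r x \<bullet> y = x \<bullet> reflect r y"
  by (simp add: reflect_def inner_diff_left inner_diff_right inner_commute)

text \<open>Conjugating a reflection by an orthogonal map moves its root by that map; in this form
  no inverse appears.\<close>

lemma reflect_conj:
  assumes "orthogonal_transformation w"
  shows "w (reflect r x) = reflect (w r) (w x)"
proof -
  have "w r \<bullet> w x = r \<bullet> x"
    using assms by (simp add: orthogonal_transformation_def)
  with assms show ?thesis
    by (simp add: reflect_def orthogonal_transformation_linear linear_diff linear_cmul)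
qed

lemma reflect_reflect_eq:
  assumes "norm r = 1"
  shows "reflect (reflect r a) = reflect r \<circ> reflect a \<circ> reflect r"
proof
  fix x
  have "reflect r a \<bullet> x = a \<bullet> reflect r x"
    by (rule inner_reflect_left)
  moreover have "reflect r (y - c *\<^sub>R a) = reflect r y - c *\<^sub>R reflect r a" for y c
    by (simp add: reflect_def inner_diff_right algebra_simps)
  ultimately show "reflect (reflect r a) x = (reflect r \<circ> reflect a \<circ> reflect r) x"
    by (simp add: reflect_def[of a] reflect_def[of "reflect r a"] reflect_reflect assms)
qed

lemma unit_inner_less:
  assumes "norm a = 1" "norm b = 1" "a \<noteq> b"
  shows "a \<bullet> b < (1::real)"
proof -
  have "(a - b) \<bullet> (a - b) = 2 - 2 * (a \<bullet> b)"
    using assms(1,2) by (simp add: norm_eq_1 inner_diff_left inner_diff_right inner_commute[of b a])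
  moreover have "(a - b) \<bullet> (a - b) > 0"
    unfolding inner_gt_zero_iff using assms(3) by simp
  ultimately show ?thesis by linarith
qed

text \<open>Evaluation at \<open>r\<close> gives \<open>reflect s r = - r\<close>, which makes
  \<open>r\<close> a multiple of \<open>s\<close>. Thus a reflection determines its root up to
  sign.\<close>

lemma reflect_eq_imp:
  assumes "norm r = 1" "norm s = 1" "reflect r = reflect s"
  shows "s = r \<or> s = - r"
proof -
  have "reflect s r = - r"
    using assms reflect_self by metis
  then have "2 *\<^sub>R r = 2 *\<^sub>R ((s \<bullet> r) *\<^sub>R s)"
    by (simp add: reflect_def algebra_simps scaleR_2)
  then have r: "r = (s \<bullet> r) *\<^sub>R s"
    by (simp only: scaleR_cancel_left) simp
  then have "norm r = \<bar>s \<bullet> r\<bar> * norm s"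
    by (metis norm_scaleR)
  then have "\<bar>s \<bullet> r\<bar> = 1"
    using assms by simp
  with r show ?thesis
    by (metis abs_eq_iff abs_1 scaleR_one scaleR_minus_left minus_minus)
qed

locale finite_orth_group =
  fixes W :: "('a::euclidean_space \<Rightarrow> 'a) set"
  assumes finite_W: "finite W"
    and id_in_W: "id \<in> W"
    and comp_in_W: "\<And>f g. f \<in> W \<Longrightarrow> g \<in> W \<Longrightarrow> f \<circ> g \<in> W"
    and inv_in_W: "\<And>f. f \<in> W \<Longrightarrow> inv_into UNIV f \<in> W"
    and orth_W: "\<And>f. f \<in> W \<Longrightarrow> orthogonal_transformation f"
begin

lemma inner_W: "w \<in> W \<Longrightarrow> w x \<bullet> w y = x \<bullet> y"
  using orth_W by (simp add: orthogonal_transformation_def)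

lemma bij_W: "w \<in> W \<Longrightarrow> bij w"
  using orth_W orthogonal_transformation_bij by blast

lemma inv_W_cancel:
  assumes "w \<in> W"
  shows "inv_into UNIV w (w x) = x" "w (inv_into UNIV w x) = x"
  using bij_W[OF assms] by (simp_all add: bij_is_inj bij_is_surj surj_f_inv_f)

lemma norm_root: "r \<in> roots W \<Longrightarrow> norm r = 1"
  and reflect_in_W: "r \<in> roots W \<Longrightarrow> reflect r \<in> W"
  by (simp_all add: roots_def)

lemma root_image:
  assumes "w \<in> W" "r \<in> roots W"
  shows "w r \<in> roots W"
proof -
  have "reflect (w r) = w \<circ> reflect r \<circ> inv_into UNIV w"
    by (simp add: fun_eq_iff reflect_conj orth_W assms inv_W_cancel)
  then have "reflect (w r) \<in> W"
    using assms by (simp add: comp_in_W inv_in_W reflect_in_W)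
  then show ?thesis
    using assms by (simp add: roots_def orth_W orthogonal_transformation_norm)
qed

lemma minus_root: "r \<in> roots W \<Longrightarrow> - r \<in> roots W"
  by (simp add: roots_def)

text \<open>The map \<open>reflect\<close> sends the roots into the finite set \<open>W\<close>,
  with fibres of at most two elements.\<close>

lemma finite_roots: "finite (roots W)"
proof -
  have "finite {r \<in> roots W. reflect r = f}" for f
  proof (cases "\<exists>r0 \<in> roots W. reflect r0 = f")
    case True
    then obtain r0 where "r0 \<in> roots W" "reflect r0 = f" by blast
    then have "{r \<in> roots W. reflect r = f} \<subseteq> {r0, - r0}"
      using reflect_eq_imp norm_root by blast
    then show ?thesis by (rule finite_subset) simp
  qed (auto intro: rev_finite_subset[of "{}"])
  then have "finite (\<Union>f\<in>W. {r \<in> roots W. reflect r = f})"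
    using finite_W by blast
  then show ?thesis
    by (rule rev_finite_subset) (auto simp: roots_def)
qed

lemma word_in_W: "set rs \<subseteq> roots W \<Longrightarrow> word rs \<in> W"
  by (induction rs) (auto simp: id_in_W intro!: comp_in_W reflect_in_W)

end

locale finite_reflection_group = finite_orth_group +
  assumes generated: "w \<in> W \<Longrightarrow> \<exists>rs. set rs \<subseteq> roots W \<and> w = word rs"

section \<open>Simple roots and the trivial stabilizer of a regular vector\<close>

locale regular_vector = finite_reflection_group W
  for W :: "('a::euclidean_space \<Rightarrow> 'a) set" +
  fixes v :: 'a
  assumes regular: "r \<in> roots W \<Longrightarrow> r \<bullet> v \<noteq> 0"
begin

definition positive :: "'a set" where
  "positive = {r \<in> roots W. r \<bullet> v > 0}"

text \<open>A familiar property of simple roots serves as the definition: \<open>reflect a\<close>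
  keeps every positive root other than \<open>a\<close> positive. The exchange argument uses exactly
  this.\<close>

definition simple :: "'a set" where
  "simple = {a \<in> positive. \<forall>b\<in>positive. b \<noteq> a \<longrightarrow> reflect a b \<bullet> v > 0}"

lemma simple_roots: "simple \<subseteq> roots W"
  by (auto simp: simple_def positive_def)

text \<open>Prepares a descent on the height \<open>a \<bullet> v\<close>: \<open>reflect a\<close>
  is the conjugate by \<open>reflect e\<close> of the reflection in \<open>reflect e a\<close>, and
  up to sign both roots are lower than \<open>a\<close>. Failure of simplicity provides a positive
  \<open>b\<close> with \<open>- reflect a b\<close> positive, and \<open>e\<close> is the lower of
  these two.\<close>

lemma positive_split:
  assumes a: "a \<in> positive" "a \<notin> simple"
  obtains e where "e \<in> positive" "e \<bullet> v < a \<bullet> v" "\<bar>reflect e a \<bullet> v\<bar> < a \<bullet> v"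
proof -
  obtain b where b: "b \<in> positive" "b \<noteq> a" "\<not> reflect a b \<bullet> v > 0"
    using a by (auto simp: simple_def)
  define c where "c = a \<bullet> b"
  define g where "g = - reflect a b"
  have aroot: "a \<in> roots W" and broot: "b \<in> roots W" and av: "a \<bullet> v > 0" and bv: "b \<bullet> v > 0"
    using a b by (auto simp: positive_def)
  have ab: "reflect a b \<in> roots W"
    using aroot broot by (simp add: root_image reflect_in_W)
  then have gv: "g \<bullet> v > 0"
    using b(3) regular[OF ab] by (simp add: g_def)
  have g: "g \<in> positive"
    using gv ab minus_root by (simp add: positive_def g_def)
  have g_eq: "g = (2 * c) *\<^sub>R a - b"
    by (simp add: g_def reflect_def c_def)
  have ag: "a \<bullet> g = c"
    using norm_root[OF aroot] by (simp add: g_eq inner_diff_right c_def dot_square_norm)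
  have c1: "c < 1"
    unfolding c_def using unit_inner_less norm_root aroot broot b(2) by metis
  have sum: "b \<bullet> v + g \<bullet> v = 2 * c * (a \<bullet> v)"
    by (simp add: g_eq inner_diff_left)
  then have c0: "c > 0"
    using bv gv av by (smt (verit) mult_nonneg_nonpos2 mult_nonpos_nonneg)
  \<comment> \<open>Since \<open>b + g = 2 c a\<close>, the smaller of \<open>b \<bullet> v\<close> and \<open>g \<bullet> v\<close> is at most \<open>c (a \<bullet> v)\<close>.\<close>
  obtain e where e: "e \<in> positive" "a \<bullet> e = c" "e \<bullet> v \<le> c * (a \<bullet> v)"
  proof (cases "b \<bullet> v \<le> g \<bullet> v")
    case True
    show ?thesis by (rule that[of b]) (use True sum b c_def in auto)
  next
    case False
    show ?thesis by (rule that[of g]) (use False sum g ag in auto)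
  qed
  have ev: "e \<bullet> v > 0"
    using e(1) by (simp add: positive_def)
  have lt: "c * (a \<bullet> v) < a \<bullet> v"
    using c1 av by simp
  have "reflect e a \<bullet> v = a \<bullet> v - 2 * c * (e \<bullet> v)"
    using e(2) by (simp add: reflect_def inner_diff_left inner_commute[of e a])
  moreover have "0 < c * (e \<bullet> v)" "c * (e \<bullet> v) < e \<bullet> v"
    using c0 c1 ev by simp_all
  ultimately have "\<bar>reflect e a \<bullet> v\<bar> < a \<bullet> v"
    using e(3) lt by linarith
  then show ?thesis
    using that[of e] e lt by linarith
qed

lemma positive_reflect_word:
  assumes "a \<in> positive"
  shows "\<exists>rs. set rs \<subseteq> simple \<and> reflect a = word rs"
proof (rule ccontr)
  \<comment> \<open>There are finitely many roots, so a counterexample of least height can be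
    chosen.\<close>
  define bad where "bad = {a \<in> positive. \<nexists>rs. set rs \<subseteq> simple \<and> reflect a = word rs}"
  assume "\<nexists>rs. set rs \<subseteq> simple \<and> reflect a = word rs"
  then have "bad \<noteq> {}"
    using assms by (auto simp: bad_def)
  moreover have "finite bad"
    by (rule finite_subset[OF _ finite_roots]) (auto simp: bad_def positive_def)
  ultimately obtain m where m: "is_arg_min (\<lambda>a. a \<bullet> v) (\<lambda>a. a \<in> bad) m"
    using ex_is_arg_min_if_finite by blast
  then have mb: "m \<in> bad" and good: "b \<in> positive \<Longrightarrow> b \<bullet> v < m \<bullet> v \<Longrightarrow>
      \<exists>rs. set rs \<subseteq> simple \<and> reflect b = word rs" for b
    by (auto simp: is_arg_min_def bad_def)
  have "m \<notin> simple"
  proof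
    assume "m \<in> simple"
    then have "set [m] \<subseteq> simple \<and> reflect m = word [m]"
      by (simp add: fun_eq_iff)
    with mb show False unfolding bad_def by blast
  qed
  then obtain e where e: "e \<in> positive" "e \<bullet> v < m \<bullet> v" "\<bar>reflect e m \<bullet> v\<bar> < m \<bullet> v"
    using positive_split[of m] mb unfolding bad_def by blast
  have ne: "norm e = 1" and root: "reflect e m \<in> roots W"
    using e mb by (auto simp: positive_def bad_def norm_root root_image reflect_in_W)
  obtain rs where rs: "set rs \<subseteq> simple" "reflect e = word rs"
    using good e by blast
  obtain ss where ss: "set ss \<subseteq> simple" "reflect (reflect e m) = word ss"
  proof (cases "reflect e m \<bullet> v > 0")
    case True
    then show ?thesis using good[of "reflect e m"] e root that by (auto simp: positive_def)
  next
    case False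
    then have "- reflect e m \<in> positive"
      using regular[OF root] minus_root[OF root] by (simp add: positive_def)
    then show ?thesis using good[of "- reflect e m"] e that by (auto simp: abs_less_iff)
  qed
  have "reflect m = reflect e \<circ> reflect (reflect e m) \<circ> reflect e"
    by (simp add: reflect_reflect_eq[OF ne] fun_eq_iff reflect_reflect[OF ne])
  then have "reflect m = word rs \<circ> word ss \<circ> word rs"
    unfolding ss(2) unfolding rs(2) .
  then have "reflect m = word (rs @ ss @ rs)"
    by (simp only: word_append o_assoc)
  moreover have "set (rs @ ss @ rs) \<subseteq> simple"
    using rs ss by simp
  ultimately show False
    using mb unfolding bad_def by blast
qed

lemma simple_word:
  assumes "w \<in> W"
  shows "\<exists>rs. set rs \<subseteq> simple \<and> w = word rs"
proof -
  have "\<exists>ss. set ss \<subseteq> simple \<and> word rs = word ss" if "set rs \<subseteq> roots W" for rs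
    using that
  proof (induction rs)
    case Nil
    then show ?case by (intro exI[of _ "[]"]) simp
  next
    case (Cons r rs)
    then obtain ss where ss: "set ss \<subseteq> simple" "word rs = word ss"
      by auto
    have "r \<in> positive \<or> - r \<in> positive"
      using Cons.prems regular[of r] minus_root[of r] by (auto simp: positive_def)
    then obtain us where "set us \<subseteq> simple" "reflect r = word us"
      using positive_reflect_word reflect_minus by metis
    with ss show ?case
      by (intro exI[of _ "us @ ss"]) (simp add: word_append)
  qed
  with generated[OF assms] show ?thesis by metis
qed

text \<open>Apply the letters of the word to \<open>a\<close> from the right until the image first
  turns negative. Just before the responsible letter \<open>s\<close> the image is a positive root
  made negative by \<open>reflect s\<close>, hence it is \<open>s\<close> itself. By conjugation,
  the final \<open>reflect a\<close> then cancels this letter.\<close>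

lemma exchange:
  assumes "set rs \<subseteq> simple" "a \<in> simple" "word rs a \<bullet> v < 0"
  shows "\<exists>ss. set ss \<subseteq> simple \<and> length ss < length rs \<and> word rs \<circ> reflect a = word ss"
  using assms
proof (induction rs)
  case Nil
  then show ?case by (simp add: simple_def positive_def)
next
  case (Cons s rs)
  have na: "norm a = 1" and ra: "a \<in> roots W" and s: "s \<in> simple" and rs: "set rs \<subseteq> roots W"
    using Cons.prems simple_roots norm_root by auto
  show ?case
  proof (cases "word rs a \<bullet> v < 0")
    case True
    then obtain ss where "set ss \<subseteq> simple" "length ss < length rs" "word rs \<circ> reflect a = word ss"
      using Cons.IH[OF _ Cons.prems(2) True] Cons.prems(1) unfolding list.set by blast
    then show ?thesis
      using s by (intro exI[of _ "s # ss"] conjI) (auto simp only: word_simps comp_assoc list.set list.size)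
  next
    case False
    have W: "word rs \<in> W" using rs by (rule word_in_W)
    have "word rs a \<in> positive"
      using False root_image[OF W ra] regular by (force simp: positive_def)
    then have eq: "word rs a = s"
      using s Cons.prems(3) by (auto simp: simple_def)
    have "reflect s (word rs (reflect a x)) = word rs x" for x
      using reflect_conj[OF orth_W[OF W], of a "reflect a x"] by (simp add: eq reflect_reflect na)
    then have eq': "word (s # rs) \<circ> reflect a = word rs"
      by (simp add: fun_eq_iff)
    show ?thesis
      unfolding eq' using Cons.prems by (intro exI[of _ rs]) auto
  qed
qed

text \<open>Induction on the length of a word in simple reflections: a nonempty word that fixes
  \<open>v\<close> can always be replaced by a shorter word for the same element.\<close>

lemma stabilizer_trivial:
  assumes "w \<in> W" "w v = v"
  shows "w = id"
proof -
  have "word rs = id" if "set rs \<subseteq> simple" "word rs v = v" for rs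
    using that
  proof (induction rs rule: length_induct)
    case (1 rs)
    show ?case
    proof (cases rs rule: rev_cases)
      case Nil
      then show ?thesis by simp
    next
      case (snoc us a)
      have a: "a \<in> simple" "a \<in> roots W" "norm a = 1" "a \<bullet> v > 0" and us: "set us \<subseteq> simple"
        using 1 snoc simple_roots norm_root by (auto simp: simple_def positive_def)
      have rsW: "word rs \<in> W" and usW: "word us \<in> W"
        using 1 us simple_roots by (auto intro!: word_in_W)
      have eq: "word rs = word us \<circ> reflect a"
        by (simp add: snoc word_append)
      have "word rs a = - word us a"
        using orth_W[OF usW] by (simp add: eq reflect_self a orthogonal_transformation_linear linear_neg)
      \<comment> \<open>Both \<open>a\<close> and \<open>v\<close> are moved by the same orthogonal
        map, which fixes \<open>v\<close>, so the height of \<open>a\<close> is unchanged.\<close>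
      moreover have "word rs a \<bullet> v > 0"
        using inner_W[OF rsW, of a v] 1 a by simp
      ultimately have "word us a \<bullet> v < 0" by simp
      then obtain ss where "set ss \<subseteq> simple" "length ss < length us" "word us \<circ> reflect a = word ss"
        using exchange us a by blast
      then show ?thesis
        using 1 eq snoc by auto
    qed
  qed
  then show ?thesis
    using simple_word assms by blast
qed

end

section \<open>Roots orthogonal to a vector with nontrivial stabilizer\<close>

context finite_reflection_group
begin

lemma stabilizer_root:
  assumes "w \<in> W" "w v = v" "w \<noteq> id"
  obtains r where "r \<in> roots W" "r \<bullet> v = 0"
proof -
  have "\<not> regular_vector W v"
    using regular_vector.stabilizer_trivial assms by blast
  then show ?thesis
    using that finite_reflection_group_axioms
    by (auto simp: regular_vector_def regular_vector_axioms_def)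
qed

text \<open>A nontrivial stabilizer yields one root \<open>r\<close> orthogonal to \<open>v\<close>.
  If it were the only one up to sign, the stabilizer would contain nothing besides \<open>id\<close>
  and \<open>reflect r\<close>, and its fixed space would contain a hyperplane.\<close>

lemma stabilizer_two_roots:
  fixes v :: 'a
  defines "L \<equiv> fixed_space {w \<in> W. w v = v}"
  assumes codim: "dim L + 2 \<le> DIM('a)"
  obtains r s where "r \<in> roots W" "s \<in> roots W" "r \<noteq> s" "r \<noteq> - s"
    "\<And>x. x \<in> L \<Longrightarrow> r \<bullet> x = 0" "\<And>x. x \<in> L \<Longrightarrow> s \<bullet> x = 0"
proof -
  \<comment> \<open>The reflection in a root orthogonal to \<open>v\<close> belongs to the
    stabilizer, so it fixes \<open>L\<close> pointwise.\<close>
  have perp: "r \<bullet> x = 0" if "r \<in> roots W" "r \<bullet> v = 0" "x \<in> L" for r x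
    using that reflect_eq_self_iff[OF norm_root[OF that(1)], of x] reflect_in_W[of r] reflect_fixes[of r v]
    by (auto simp: L_def fixed_space_def)
  have "\<exists>w\<in>W. w v = v \<and> w \<noteq> id"
  proof (rule ccontr)
    assume "\<not> ?thesis"
    then have "L = UNIV" by (auto simp: L_def fixed_space_def)
    with codim show False by simp
  qed
  then obtain r where r: "r \<in> roots W" "r \<bullet> v = 0"
    using stabilizer_root by blast
  have "\<exists>s\<in>roots W. s \<bullet> v = 0 \<and> r \<noteq> s \<and> r \<noteq> - s"
  proof (rule ccontr)
    assume "\<not> ?thesis"
    then have only: "s = r \<or> s = - r" if "s \<in> roots W" "s \<bullet> v = 0" for s
      using that by (metis minus_minus)
    have rr: "r \<bullet> r = 1" using norm_root[OF r(1)] by (simp add: dot_square_norm)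
    \<comment> \<open>If \<open>r\<close> were the only root up to sign, a generic \<open>v + \<epsilon> r\<close> would be orthogonal to no root.\<close>
    obtain \<epsilon> where "\<epsilon> \<notin> insert 0 ((\<lambda>t. - (t \<bullet> v) / (t \<bullet> r)) ` roots W)"
      using ex_new_if_finite[OF infinite_UNIV_char_0 finite.insertI[OF finite_imageI[OF finite_roots]]]
      by blast
    then have \<epsilon>: "\<epsilon> \<noteq> 0" "\<And>t. t \<in> roots W \<Longrightarrow> \<epsilon> \<noteq> - (t \<bullet> v) / (t \<bullet> r)" by auto
    have reg: "t \<bullet> (v + \<epsilon> *\<^sub>R r) \<noteq> 0" if t: "t \<in> roots W" for t
    proof (cases "t \<bullet> v = 0")
      case True
      then show ?thesis using only[OF t True] \<epsilon>(1) r rr by (auto simp: inner_add_right)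
    next
      case False
      then show ?thesis using \<epsilon>(2)[OF t] by (cases "t \<bullet> r = 0") (auto simp: inner_add_right field_simps)
    qed
    have triv: "h = id" if "h \<in> W" "h v = v" "h r = r" for h
    proof -
      have "h (v + \<epsilon> *\<^sub>R r) = v + \<epsilon> *\<^sub>R r"
        using that orth_W[of h]
        by (simp add: orthogonal_transformation_linear linear_add linear_cmul)
      then show ?thesis
        using stabilizer_root[of h] that reg by metis
    qed
    \<comment> \<open>The image \<open>h r\<close> is again a root orthogonal to \<open>v\<close>,
      hence \<open>r\<close> or \<open>- r\<close>; the second case reduces to the first after
      composing with \<open>reflect r\<close>.\<close>
    have H: "h = id \<or> h = reflect r" if h: "h \<in> W" "h v = v" for h
    proof -
      have "h r \<bullet> v = 0" using inner_W[OF h(1), of r v] h r by simp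
      then consider "h r = r" | "h r = - r" using only root_image h r by blast
      then show ?thesis
      proof cases
        case 1
        then show ?thesis using triv h by blast
      next
        case 2
        have "h \<circ> reflect r = id"
        proof (rule triv)
          show "(h \<circ> reflect r) r = r"
            using 2 orth_W[OF h(1)] norm_root[OF r(1)]
            by (simp add: reflect_self orthogonal_transformation_linear linear_neg)
        qed (use h r in \<open>auto simp: comp_in_W reflect_in_W reflect_fixes\<close>)
        then have "h (reflect r (reflect r x)) = reflect r x" for x by (simp add: fun_eq_iff)
        then have "h = reflect r" using norm_root[OF r(1)] by (simp add: reflect_reflect fun_eq_iff)
        then show ?thesis ..
      qed
    qed
    then have "{x. r \<bullet> x = 0} \<subseteq> L"
      unfolding L_def fixed_space_def using reflect_fixes by fastforce
    moreover have "dim {x. r \<bullet> x = 0} = DIM('a) - 1"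
      using norm_root[OF r(1)] by (intro dim_hyperplane) auto
    ultimately show False
      using codim dim_subset[of "{x. r \<bullet> x = 0}" L] by linarith
  qed
  then show ?thesis
    using that r perp by metis
qed

end

section \<open>From the abstract notion of a reflection group to words in roots\<close>

lemma reflection_eq_reflect:
  fixes g :: "'a::euclidean_space \<Rightarrow> 'a"
  assumes orth: "orthogonal_transformation g" and refl: "is_reflection g"
  obtains r where "norm r = 1" "g = reflect r"
proof -
  define F where "F = fixed_space {g}"
  have lin: "linear g" and inner: "g x \<bullet> g y = x \<bullet> y" for x y
    using orth by (simp_all add: orthogonal_transformation_def)
  have F: "x \<in> F \<longleftrightarrow> g x = x" for x
    by (simp add: F_def fixed_space_def)
  have sub: "subspace F"
    by (simp add: subspace_def F linear_add[OF lin] linear_cmul[OF lin] linear_0[OF lin])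
  have dim: "dim F + 1 = DIM('a)"
    using refl by (simp add: is_reflection_def F_def)
  then obtain r0 where r0: "r0 \<noteq> 0" "\<And>y. y \<in> span F \<Longrightarrow> orthogonal r0 y"
    using orthogonal_to_subspace_exists[of F] by auto
  define r where "r = r0 /\<^sub>R norm r0"
  have r: "norm r = 1" "\<And>y. y \<in> F \<Longrightarrow> r \<bullet> y = 0"
    using r0 span_base by (auto simp: r_def orthogonal_def)
  have r_ne: "r \<noteq> 0" using r(1) by auto
  have F_eq: "F = {x. r \<bullet> x = 0}"
    by (rule subspace_dim_equal[OF sub subspace_hyperplane])
       (use r dim dim_hyperplane[OF r_ne] in auto)
  define c where "c = r \<bullet> g r"
  \<comment> \<open>This is the component of \<open>g r\<close> orthogonal to \<open>r\<close>. It
    lies in \<open>F\<close>, so \<open>g\<close> fixes it, and preservation of inner products then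
    forces it to vanish.\<close>
  define d where "d = g r - c *\<^sub>R r"
  have rr: "r \<bullet> r = 1" using r(1) by (simp add: norm_eq_1)
  have rd: "r \<bullet> d = 0" by (simp add: d_def c_def inner_diff_right rr)
  then have "g d = d" using F F_eq by blast
  then have "g r \<bullet> d = r \<bullet> d" using inner[of r d] by simp
  then have "d \<bullet> d = 0" using rd by (simp add: d_def inner_diff_left)
  then have gr: "g r = c *\<^sub>R r" by (simp add: d_def)
  have "c * c = 1" using inner[of r r] by (simp add: gr rr)
  moreover have "c \<noteq> 1"
  proof
    assume "c = 1"
    then have "r \<in> F" using F gr by simp
    then show False using F_eq rr by simp
  qed
  ultimately have c: "c = - 1" by (metis square_eq_1_iff)
  have "g x = reflect r x" for x
  proof -
    have "r \<bullet> (x - (r \<bullet> x) *\<^sub>R r) = 0" by (simp add: inner_diff_right rr)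
    then have "g (x - (r \<bullet> x) *\<^sub>R r) = x - (r \<bullet> x) *\<^sub>R r" using F F_eq by blast
    then have "g x - (r \<bullet> x) *\<^sub>R (- r) = x - (r \<bullet> x) *\<^sub>R r"
      by (simp add: linear_diff[OF lin] linear_cmul[OF lin] gr c)
    then show ?thesis by (simp add: reflect_def algebra_simps flip: scaleR_2)
  qed
  then show ?thesis using that r(1) by blast
qed

lemma GL_simps [simp]: "f \<otimes>\<^bsub>GL\<^esub> g = f \<circ> g" "\<one>\<^bsub>GL\<^esub> = id"
  by (simp_all add: GL_def)

lemma carrier_GL: "f \<in> carrier GL \<longleftrightarrow> linear f \<and> bij f"
  by (simp add: GL_def)

lemma inv_GL_eq:
  assumes "f \<in> carrier GL" "g \<in> carrier GL" "g \<circ> f = id"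
  shows "inv\<^bsub>GL\<^esub> f = g"
  using group.inv_equality[OF group_GL, of g f] assms by simp

text \<open>A generated subgroup admits inverses of generators, but a reflection is its own inverse,
  so plain words in reflections exhaust the group.\<close>

lemma reflection_group_locale:
  fixes W :: "('a::euclidean_space \<Rightarrow> 'a) set"
  assumes "W \<subseteq> orthogonal_group" "reflection_group W"
  shows "finite_reflection_group W"
proof -
  have fin: "finite W" and sub: "subgroup W GL" and gen: "generate GL {g \<in> W. is_reflection g} = W"
    using assms(2) by (auto simp: reflection_group_def finite_linear_group_def)
  have orth: "orthogonal_transformation f" if "f \<in> W" for f
    using that assms(1) by (auto simp: orthogonal_group_def)
  have car: "f \<in> carrier GL" if "f \<in> W" for f
    using that subgroup.mem_carrier[OF sub] by blast
  interpret finite_orth_group W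
  proof
    show "inv_into UNIV f \<in> W" if f: "f \<in> W" for f
    proof -
      have "f \<circ> inv\<^bsub>GL\<^esub> f = id"
        using group.r_inv[OF group_GL car[OF f]] by simp
      then have "inv_into UNIV f = inv\<^bsub>GL\<^esub> f"
        using car[OF f] by (metis carrier_GL bij_is_inj inv_unique_comp inv_o_cancel o_assoc id_comp comp_id)
      then show ?thesis
        using subgroup.m_inv_closed[OF sub f] by simp
    qed
    show "f \<circ> g \<in> W" if "f \<in> W" "g \<in> W" for f g
      using subgroup.m_closed[OF sub that] by simp
    show "id \<in> W"
      using subgroup.one_closed[OF sub] by simp
  qed (use fin orth in auto)
  have reflection: "\<exists>r \<in> roots W. g = reflect r" if "g \<in> W" "is_reflection g" for g
    using reflection_eq_reflect[OF orth[OF that(1)] that(2)] that(1) by (auto simp: roots_def)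
  show ?thesis
  proof
    fix w assume "w \<in> W"
    then have "w \<in> generate GL {g \<in> W. is_reflection g}" by (simp add: gen)
    then show "\<exists>rs. set rs \<subseteq> roots W \<and> w = word rs"
    proof induction
      case one
      then show ?case by (intro exI[of _ "[]"]) simp
    next
      case (incl h)
      then obtain r where "r \<in> roots W" "h = reflect r" using reflection by blast
      then show ?case by (intro exI[of _ "[r]"]) simp
    next
      case (inv h)
      then obtain r where r: "r \<in> roots W" "h = reflect r" using reflection by blast
      then have "inv\<^bsub>GL\<^esub> h = h"
        using inv car norm_root by (intro inv_GL_eq) (auto simp: reflect_comp_reflect)
      with r show ?case by (intro exI[of _ "[r]"]) simp
    next
      case (eng f g)
      then obtain rs ss where "set rs \<subseteq> roots W" "f = word rs" "set ss \<subseteq> roots W" "g = word ss"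
        by blast
      then show ?case by (intro exI[of _ "rs @ ss"]) (simp add: word_append)
    qed
  qed
qed

section \<open>Pairs of roots at a small angle\<close>

lemma span_pair_iff:
  "v \<in> span {u, w} \<longleftrightarrow> (\<exists>x y. v = x *\<^sub>R u + y *\<^sub>R w)"
  by (auto simp: span_insert span_singleton algebra_simps eq_diff_eq)

text \<open>On the plane of \<open>r\<close> and \<open>s\<close> the product of the two reflections
  is a rotation by twice the angle between them; the factor is the double-angle formula for its
  cosine.\<close>

lemma inner_rotation:
  fixes r s p :: "'a::euclidean_space"
  assumes "norm r = 1" "norm s = 1" "p \<in> span {r, s}"
  shows "p \<bullet> reflect r (reflect s p) = (2 * (r \<bullet> s)\<^sup>2 - 1) * (p \<bullet> p)"
proof -
  obtain x y where p: "p = x *\<^sub>R r + y *\<^sub>R s"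
    using assms(3) by (auto simp: span_pair_iff)
  have rr: "r \<bullet> r = 1" "s \<bullet> s = 1" "s \<bullet> r = r \<bullet> s"
    using assms by (simp_all add: norm_eq_1 inner_commute)
  have "p \<bullet> reflect r (reflect s p) = reflect r p \<bullet> reflect s p"
    by (simp add: inner_reflect_left)
  also have "\<dots> = (2 * (r \<bullet> s)\<^sup>2 - 1) * (p \<bullet> p)"
    by (simp add: p reflect_def inner_diff_left inner_diff_right inner_add_left inner_add_right rr
        power2_eq_square algebra_simps)
  finally show ?thesis .
qed

context finite_orth_group
begin

text \<open>If a reflection through \<open>t\<close> moved the axis \<open>a\<close> of the rotation \<open>g\<close> (of angle at most
  \<open>\<pi>/3\<close>) inside the 3-space spanned by \<open>a\<close>, \<open>r\<close>, \<open>s\<close>, then for a pair of distinct axes at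
  minimal angle, rotating one axis about the other would give a pair at a smaller angle.\<close>

lemma small_angle_roots:
  assumes r: "r \<in> roots W" and s: "s \<in> roots W" and t: "t \<in> roots W"
    and ne: "r \<noteq> s" "r \<noteq> - s" and angle: "(r \<bullet> s)\<^sup>2 \<ge> 3 / 4"
  shows "t \<in> span {r, s} \<or> (t \<bullet> r = 0 \<and> t \<bullet> s = 0)"
proof (rule ccontr)
  assume contra: "\<not> ?thesis"
  obtain q a where q: "q \<in> span {r, s}" and a: "\<And>w. w \<in> span {r, s} \<Longrightarrow> a \<bullet> w = 0"
    and t_eq: "t = q + a"
    using orthogonal_subspace_decomp_exists[of "{r, s}" t] unfolding orthogonal_def by metis
  have ar: "a \<bullet> r = 0" and as: "a \<bullet> s = 0" and aq: "a \<bullet> q = 0"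
    using a q span_base[of _ "{r, s}"] by auto
  have "a \<noteq> 0" "q \<noteq> 0"
    using contra q ar as by (auto simp: t_eq)
  define A where "A = a \<bullet> a"
  define K where "K = r \<bullet> s"
  have "q \<bullet> q > 0" and A0: "A > 0"
    using \<open>a \<noteq> 0\<close> \<open>q \<noteq> 0\<close> by (simp_all add: A_def)
  moreover have "q \<bullet> q + A = 1"
    using norm_root[OF t] aq by (simp add: norm_eq_1 t_eq A_def inner_add_left inner_add_right inner_commute)
  ultimately have A1: "A < 1" by linarith
  have "\<bar>K\<bar> < 1"
    using unit_inner_less[of r s] unit_inner_less[of r "- s"] norm_root r s ne
    by (auto simp: K_def abs_less_iff)
  then have K1: "K\<^sup>2 < 1" by (simp add: abs_square_less_1)
  \<comment> \<open>Inside this 3-space the orthogonal complement of \<open>span {r, s}\<close> is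
    the line through \<open>a\<close>, so rotations have an axis. \<open>W0\<close> collects the
    elements that preserve it.\<close>
  define E where "E = span {a, r, s}"
  define W0 where "W0 = {w \<in> W. w ` E = E}"
  have W0_W: "w \<in> W" if "w \<in> W0" for w using that by (simp add: W0_def)
  have refl_W0: "reflect u \<in> W0" if u: "u \<in> roots W" "u \<in> E" for u
  proof -
    have "reflect u x \<in> E" if "x \<in> E" for x
      using that u(2) by (simp add: E_def reflect_def span_diff span_scale)
    moreover have "reflect u (reflect u x) = x" for x
      using norm_root[OF u(1)] by (rule reflect_reflect)
    ultimately have "reflect u ` E = E" by (metis image_eqI image_subsetI subsetI subset_antisym)
    then show ?thesis using u by (simp add: W0_def reflect_in_W)
  qed
  have comp_W0: "f \<circ> g \<in> W0" if "f \<in> W0" "g \<in> W0" for f g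
    using that comp_in_W[of f g] image_comp[of f g E] unfolding W0_def by auto
  have inv_W0: "inv_into UNIV f \<in> W0" if "f \<in> W0" for f
    using that image_inv_f_f[OF bij_is_inj[OF bij_W], of f E] by (simp add: W0_def inv_in_W)
  have subE: "span {r, s} \<subseteq> E"
    unfolding E_def by (rule span_mono) auto
  have aE: "a \<in> E" and rE: "r \<in> E" and sE: "s \<in> E"
    unfolding E_def by (auto intro: span_base)
  have tE: "t \<in> E"
    unfolding t_eq E_def using subE q aE span_add[of q "{a, r, s}" a] unfolding E_def by blast
  \<comment> \<open>All images of \<open>a\<close> have the same length, so \<open>Y\<close>
    consists of those in the orbit other than \<open>a\<close> and \<open>- a\<close>. The
    assumption on \<open>t\<close> makes \<open>Y\<close> nonempty.\<close>
  define X where "X = (\<lambda>w. w a) ` W0"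
  define Y where "Y = {y \<in> X. \<bar>a \<bullet> y\<bar> < A}"
  have "finite Y"
    using finite_W by (simp add: Y_def X_def W0_def)
  moreover have "reflect t a \<in> Y"
  proof -
    have "a \<bullet> t = A" using aq by (simp add: t_eq A_def inner_add_right)
    then have "a \<bullet> reflect t a = A * (1 - 2 * A)"
      by (simp add: reflect_def inner_diff_right inner_commute[of t a] A_def[symmetric] algebra_simps)
    moreover have "A * A < A" "A * A > 0" using A0 A1 by simp_all
    ultimately have "\<bar>a \<bullet> reflect t a\<bar> < A" by (simp add: abs_less_iff algebra_simps)
    then show ?thesis using refl_W0[OF t tE] by (auto simp: Y_def X_def)
  qed
  \<comment> \<open>Among these axes, \<open>y\<close> is one at the smallest angle to the line of
    \<open>a\<close>.\<close>
  ultimately obtain y where "is_arg_min (\<lambda>y. - \<bar>a \<bullet> y\<bar>) (\<lambda>y. y \<in> Y) y"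
    using ex_is_arg_min_if_finite by blast
  then have y: "y \<in> Y" and y_max: "\<And>z. z \<in> Y \<Longrightarrow> \<bar>a \<bullet> z\<bar> \<le> \<bar>a \<bullet> y\<bar>"
    by (auto simp: is_arg_min_linorder)
  obtain w where w: "w \<in> W0" "y = w a" using y by (auto simp: Y_def X_def)
  have "y \<in> E" using w aE by (auto simp: W0_def)
  then obtain k where k: "y - k *\<^sub>R a \<in> span {r, s}"
    unfolding E_def span_breakdown_eq[of y a] by blast
  define p where "p = y - k *\<^sub>R a"
  have y_eq: "y = k *\<^sub>R a + p" and p: "p \<in> span {r, s}" and ap: "a \<bullet> p = 0"
    using k a by (simp_all add: p_def)
  define g where "g = reflect r \<circ> reflect s"
  have g: "g \<in> W0" unfolding g_def using refl_W0 r s rE sE comp_W0 by blast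
  have ga: "g a = a" using ar as by (simp add: g_def reflect_fixes inner_commute[of _ a])
  have gp: "g p \<in> span {r, s}"
    using p by (auto simp: g_def reflect_def intro!: span_diff span_scale intro: span_base)
  have gy: "g y = k *\<^sub>R a + g p"
    using orth_W[OF W0_W[OF g]] ga
    by (simp add: y_eq orthogonal_transformation_linear linear_add linear_cmul)
  have pp: "p \<bullet> p = A - k\<^sup>2 * A"
  proof -
    have "y \<bullet> y = A" using inner_W[OF W0_W[OF w(1)], of a a] w(2) by (simp add: A_def)
    then show ?thesis using ap
      by (simp add: y_eq inner_add_left inner_add_right inner_commute[of p a] A_def power2_eq_square)
  qed
  have "p \<bullet> g p = (2 * K\<^sup>2 - 1) * (p \<bullet> p)"
    unfolding g_def K_def comp_apply using p norm_root r s by (intro inner_rotation) auto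
  then have ygy: "y \<bullet> g y = A * (k\<^sup>2 + (2 * K\<^sup>2 - 1) * (1 - k\<^sup>2))"
    using a[OF gp] ap unfolding gy pp unfolding y_eq
    by (simp add: inner_add_left inner_add_right inner_commute[of p a] A_def power2_eq_square algebra_simps)
  \<comment> \<open>\<open>g\<close> turns the axis \<open>y\<close> about \<open>a\<close>. Pulling
    the pair \<open>y\<close>, \<open>g y\<close> back by \<open>w\<close> gives the pair
    \<open>a\<close>, \<open>z\<close> with the same inner product.\<close>
  define z where "z = inv_into UNIV w (g (w a))"
  have "z = (inv_into UNIV w \<circ> (g \<circ> w)) a" by (simp add: z_def)
  then have zX: "z \<in> X" unfolding X_def using comp_W0 inv_W0 w g by blast
  have az: "a \<bullet> z = y \<bullet> g y"
    using inner_W[OF W0_W[OF w(1)], of a z] inv_W_cancel[OF W0_W[OF w(1)]] by (simp add: z_def w(2))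
  have ay: "a \<bullet> y = A * k" using ap by (simp add: y_eq inner_add_right A_def)
  have "A * \<bar>k\<bar> < A * 1" using y A0 by (simp add: Y_def ay abs_mult)
  then have k1: "\<bar>k\<bar> < 1" using A0 by simp
  then have k2: "k\<^sup>2 < 1" by (simp add: abs_square_less_1)
  \<comment> \<open>As \<open>2 * K\<^sup>2 - 1\<close> is at least 1/2 and less than 1, the
    quotient \<open>a \<bullet> z / A\<close> is less than 1 and at least
    \<open>(1 + k\<^sup>2) / 2\<close>, which exceeds \<open>\<bar>k\<bar>\<close>. So
    \<open>z\<close> lies in \<open>Y\<close> and contradicts the choice of
    \<open>y\<close>.\<close>
  have "(2 * K\<^sup>2 - 1) * (1 - k\<^sup>2) < 1 * (1 - k\<^sup>2)"
    using k2 K1 by (intro mult_strict_right_mono) auto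
  moreover have "1 / 2 * (1 - k\<^sup>2) \<le> (2 * K\<^sup>2 - 1) * (1 - k\<^sup>2)"
    using k2 angle by (intro mult_right_mono) (auto simp: K_def)
  moreover have "0 < (1 - \<bar>k\<bar>)\<^sup>2" using k1 by simp
  then have "\<bar>k\<bar> < (1 + k\<^sup>2) / 2" by (simp add: power2_eq_square algebra_simps)
  ultimately have "k\<^sup>2 + (2 * K\<^sup>2 - 1) * (1 - k\<^sup>2) < 1" "\<bar>k\<bar> < k\<^sup>2 + (2 * K\<^sup>2 - 1) * (1 - k\<^sup>2)"
    by (auto simp: field_simps)
  then have "a \<bullet> z < A" "\<bar>a \<bullet> y\<bar> < a \<bullet> z"
    unfolding az ygy ay using A0 by (simp_all add: abs_mult)
  then show False
    using y_max[of z] zX by (simp add: Y_def)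
qed

end

section \<open>Complex lines in real 4-space\<close>

definition cvec :: "complex \<Rightarrow> complex \<Rightarrow> real^4" where
  "cvec a b = to_R4 (vector [a, b])"

lemma cvec_nth [simp]:
  "cvec a b $ 1 = Re a" "cvec a b $ 2 = Im a" "cvec a b $ 3 = Re b" "cvec a b $ 4 = Im b"
  by (simp_all add: cvec_def)

lemma of_R4_cvec [simp]: "of_R4 (cvec a b) $ 1 = a" "of_R4 (cvec a b) $ 2 = b"
  by (simp_all add: cvec_def)

lemma cvec_of_R4: "cvec (of_R4 x $ 1) (of_R4 x $ 2) = x"
  by (simp add: vec_eq_iff forall_4)

lemma cvec_cases:
  obtains a b where "x = cvec a b"
  using cvec_of_R4 by metis

lemma cvec_eq_iff [simp]: "cvec a b = cvec c d \<longleftrightarrow> a = c \<and> b = d"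
  by (auto simp: vec_eq_iff forall_4 complex_eq_iff)

lemma cvec_eq_0_iff [simp]: "cvec a b = 0 \<longleftrightarrow> a = 0 \<and> b = 0"
  by (auto simp: vec_eq_iff forall_4 complex_eq_iff)

lemma cvec_add: "cvec a b + cvec c d = cvec (a + c) (b + d)"
  by (simp add: vec_eq_iff forall_4)

lemma cvec_scaleR: "x *\<^sub>R cvec a b = cvec (x *\<^sub>R a) (x *\<^sub>R b)"
  by (simp add: vec_eq_iff forall_4)

lemma inner_cvec: "cvec a b \<bullet> cvec c d = Re (a * cnj c) + Re (b * cnj d)"
  by (simp add: inner_vec_def sum_4)

lemma Re_mult_cnj_pos: "c \<noteq> 0 \<Longrightarrow> 0 < Re (c * cnj c)"
  by (metis Re_complex_of_real complex_norm_square norm_eq_zero zero_less_power2)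

definition cline :: "complex \<Rightarrow> complex \<Rightarrow> (real^4) set" where
  "cline p q = range (\<lambda>z. cvec (z * p) (z * q))"

lemma cline_eq_span: "cline p q = span {cvec p q, cvec (\<i> * p) (\<i> * q)}"
proof -
  have "x *\<^sub>R cvec p q + y *\<^sub>R cvec (\<i> * p) (\<i> * q) = cvec (Complex x y * p) (Complex x y * q)" for x y
    by (simp add: cvec_scaleR cvec_add complex_eq_iff)
  then have "v \<in> span {cvec p q, cvec (\<i> * p) (\<i> * q)} \<longleftrightarrow>
      (\<exists>x y. v = cvec (Complex x y * p) (Complex x y * q))" for v
    by (simp only: span_pair_iff)
  moreover have "(\<exists>z. P z) \<longleftrightarrow> (\<exists>x y. P (Complex x y))" for P
    by (metis complex.exhaust)
  ultimately show ?thesis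
    by (simp add: cline_def image_iff set_eq_iff)
qed

lemma subspace_cline: "subspace (cline p q)"
  by (simp add: cline_eq_span)

lemma dim_cline:
  assumes "p \<noteq> 0 \<or> q \<noteq> 0"
  shows "dim (cline p q) = 2"
proof -
  have orth: "pairwise orthogonal {cvec p q, cvec (\<i> * p) (\<i> * q)}"
    by (auto simp: pairwise_insert orthogonal_def inner_cvec)
  have "cvec p q \<noteq> cvec (\<i> * p) (\<i> * q)"
    using assms by auto
  moreover have "independent {cvec p q, cvec (\<i> * p) (\<i> * q)}"
    using assms by (intro pairwise_orthogonal_independent[OF orth]) auto
  ultimately show ?thesis
    by (simp add: cline_eq_span dim_eq_card_independent)
qed

text \<open>Real orthogonality to both a vector and its multiple by \<open>\<i>\<close> is Hermitian
  orthogonality, a single complex equation whose solutions form the stated line.\<close>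

lemma cline_perp:
  assumes "p \<noteq> 0 \<or> q \<noteq> 0" "\<And>y. y \<in> cline p q \<Longrightarrow> x \<bullet> y = 0"
  shows "x \<in> cline (- cnj q) (cnj p)"
proof -
  obtain a b where x: "x = cvec a b" by (rule cvec_cases)
  have "x \<bullet> cvec (1 * p) (1 * q) = 0" "x \<bullet> cvec (\<i> * p) (\<i> * q) = 0"
    by (rule assms(2); unfold cline_def; blast)+
  then have eq: "a * cnj p + b * cnj q = 0"
    by (simp add: x inner_cvec complex_eq_iff algebra_simps)
  show ?thesis
  proof (cases "p = 0")
    case True
    then have "x = cvec (- a / cnj q * - cnj q) (- a / cnj q * cnj p)"
      using assms(1) eq by (simp add: x)
    then show ?thesis unfolding cline_def by blast
  next
    case False
    then have "x = cvec (b / cnj p * - cnj q) (b / cnj p * cnj p)"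
      using eq by (simp add: x field_simps add_eq_0_iff)
    then show ?thesis unfolding cline_def by blast
  qed
qed

lemma independent_unit_pair:
  fixes r s :: "'a::euclidean_space"
  assumes "norm r = 1" "norm s = 1" "r \<noteq> s" "r \<noteq> - s"
  shows "independent {r, s}"
proof -
  have "r \<notin> span {s}"
  proof
    assume "r \<in> span {s}"
    then obtain k where k: "r = k *\<^sub>R s" by (auto simp: span_singleton)
    then have "\<bar>k\<bar> = 1" using assms by simp
    with k assms show False by (auto simp: abs_if split: if_splits)
  qed
  then show ?thesis
    using assms(2) by (auto simp: independent_insert)
qed

lemma span_pair_eq:
  fixes u w :: "'a::euclidean_space"
  assumes "independent {u, w}" "u \<noteq> w" "u \<in> T" "w \<in> T" "subspace T" "dim T \<le> 2"
  shows "T = span {u, w}"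
proof
  show "T \<subseteq> span {u, w}"
    using assms by (intro card_ge_dim_independent) auto
  show "span {u, w} \<subseteq> T"
    using assms by (intro span_minimal) auto
qed

text \<open>A line in the arrangement is the fixed space of a stabilizer and has codimension two.
  The two independent roots found for it lie in the complementary complex line, which has real
  dimension two, and so span it.\<close>

lemma plane_roots:
  assumes "finite_reflection_group W" "cline p q \<in> subspace_arrangement W" "p \<noteq> 0 \<or> q \<noteq> 0"
  obtains r s where "r \<in> roots W" "s \<in> roots W" "cline (- cnj q) (cnj p) = span {r, s}"
proof -
  interpret finite_reflection_group W by fact
  obtain v where v: "cline p q = fixed_space {w \<in> W. w v = v}"
    using assms(2) by (auto simp: subspace_arrangement_def isotropy_subgroup_def)
  have "dim (fixed_space {w \<in> W. w v = v}) + 2 \<le> DIM(real^4)"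
    using dim_cline[OF assms(3)] v by simp
  then obtain r s where rs: "r \<in> roots W" "s \<in> roots W" "r \<noteq> s" "r \<noteq> - s"
    and perp: "\<And>x. x \<in> cline p q \<Longrightarrow> r \<bullet> x = 0" "\<And>x. x \<in> cline p q \<Longrightarrow> s \<bullet> x = 0"
    by (rule stabilizer_two_roots) (auto simp: v)
  have "dim (cline (- cnj q) (cnj p)) = 2"
    using assms(3) by (intro dim_cline) auto
  then have "cline (- cnj q) (cnj p) = span {r, s}"
    using rs perp assms(3)
    by (intro span_pair_eq independent_unit_pair norm_root cline_perp subspace_cline) auto
  then show ?thesis using that rs by blast
qed

section \<open>Pigeonhole on the unit sphere\<close>

text \<open>Finitely many balls of radius 1/4 cover the compact sphere, and \<open>N\<close> is the
  number of their centres; two points in one ball are less than 1/2 apart.\<close>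

lemma close_unit_vectors:
  obtains N :: nat where
    "\<And>S :: 'a::euclidean_space set. \<lbrakk>finite S; S \<subseteq> sphere 0 1; card S > N\<rbrakk> \<Longrightarrow>
       \<exists>r\<in>S. \<exists>s\<in>S. r \<noteq> s \<and> dist r s < 1 / 2"
proof -
  have "compact (sphere (0::'a) 1)" by simp
  then obtain C :: "'a set" where C: "finite C" "sphere 0 1 \<subseteq> (\<Union>c\<in>C. ball c (1 / 4))"
    unfolding compact_eq_totally_bounded by (metis zero_less_divide_1_iff zero_less_numeral)
  show ?thesis
  proof (rule that)
    fix S :: "'a set"
    assume S: "finite S" "S \<subseteq> sphere 0 1" "card S > card C"
    then have "\<forall>x\<in>S. \<exists>c. c \<in> C \<and> dist c x < 1 / 4"
      using C(2) by (fastforce simp: subset_eq)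
    then obtain f where f: "\<And>x. x \<in> S \<Longrightarrow> f x \<in> C \<and> dist (f x) x < 1 / 4"
      by metis
    then have "card (f ` S) \<le> card C"
      using C(1) by (intro card_mono) auto
    then have "\<not> inj_on f S"
      using S(3) by (intro pigeonhole) simp
    then obtain r s where "r \<in> S" "s \<in> S" "r \<noteq> s" "f r = f s"
      by (auto simp: inj_on_def)
    moreover from this have "dist r s < 1 / 2"
      using f[of r] f[of s] dist_triangle[of r s "f r"] by (simp add: dist_commute)
    ultimately show "\<exists>r\<in>S. \<exists>s\<in>S. r \<noteq> s \<and> dist r s < 1 / 2" by blast
  qed
qed

text \<open>The value 7/8 is good enough because its square 49/64 exceeds the threshold 3/4 of
  \<open>small_angle_roots\<close>.\<close>

lemma inner_of_dist:
  fixes r s :: "'a::euclidean_space"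
  assumes "norm r = 1" "norm s = 1" "dist r s < 1 / 2"
  shows "r \<bullet> s > 7 / 8"
proof -
  have "(r - s) \<bullet> (r - s) < (1 / 2)\<^sup>2"
    using assms(3) by (simp add: dist_norm flip: power2_norm_eq_inner) (rule power_strict_mono, auto)
  moreover have "(r - s) \<bullet> (r - s) = 2 - 2 * (r \<bullet> s)"
    using assms(1,2) by (simp add: norm_eq_1 inner_diff_left inner_diff_right inner_commute[of s r])
  ultimately show ?thesis by (simp add: power2_eq_square)
qed

section \<open>Collapse of the lines when a reflection arrangement contains them\<close>

lemma roots_of_unity_real:
  fixes W :: "(real^4 \<Rightarrow> real^4) set" and U :: "complex set"
  assumes W: "finite_reflection_group W"
    and arr0: "cline 1 0 \<in> subspace_arrangement W" "cline 0 1 \<in> subspace_arrangement W"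
    and arr: "\<And>u. u \<in> U \<Longrightarrow> cline u 1 \<in> subspace_arrangement W"
    and one: "1 \<in> U" and zero: "0 \<notin> U" and fin: "finite U"
    and N: "\<And>S :: (real^4) set. \<lbrakk>finite S; S \<subseteq> sphere 0 1; card S > N\<rbrakk> \<Longrightarrow>
       \<exists>r\<in>S. \<exists>s\<in>S. r \<noteq> s \<and> dist r s < 1 / 2"
    and card: "card U > N"
    and u: "u \<in> U"
  shows "u \<in> \<real>"
proof -
  interpret finite_reflection_group W by (rule W)
  have "\<exists>r. r \<in> roots W \<and> r \<in> cline (- 1) (cnj u)" if u: "u \<in> U" for u
  proof -
    obtain r s where rs: "r \<in> roots W" "s \<in> roots W" "cline (- cnj 1) (cnj u) = span {r, s}"
      by (rule plane_roots[OF W arr[OF u]]) auto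
    then show ?thesis
      using span_base[of r "{r, s}"] by auto
  qed
  then obtain \<rho> where \<rho>: "\<And>u. u \<in> U \<Longrightarrow> \<rho> u \<in> roots W \<and> \<rho> u \<in> cline (- 1) (cnj u)"
    by metis
  have nz: "x \<noteq> 0" if "x \<in> roots W" for x
    using norm_root[OF that] by auto
  \<comment> \<open>The complements of lines with different slopes meet only in 0, and a root is
    nonzero.\<close>
  have "inj_on \<rho> U"
  proof (rule inj_onI)
    fix u v assume uv: "u \<in> U" "v \<in> U" "\<rho> u = \<rho> v"
    then show "u = v"
      using \<rho>[of u] \<rho>[of v] nz[of "\<rho> u"] by (auto simp: cline_def)
  qed
  then have "card (\<rho> ` U) > N"
    using card by (simp add: card_image)
  then obtain r s where rs: "r \<in> \<rho> ` U" "s \<in> \<rho> ` U" "r \<noteq> s" "dist r s < 1 / 2"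
    using N[of "\<rho> ` U"] fin \<rho> norm_root by (auto simp: subset_eq)
  have r: "r \<in> roots W" and s: "s \<in> roots W"
    using rs \<rho> by auto
  have inner: "r \<bullet> s > 7 / 8"
    using rs r s by (intro inner_of_dist norm_root)
  then have "r \<noteq> - s" "(r \<bullet> s)\<^sup>2 \<ge> 3 / 4"
    using norm_root[OF s] mult_strict_mono[OF inner inner]
    by (auto simp: norm_eq_1 power2_eq_square)
  note dichotomy = small_angle_roots[OF r s _ rs(3) this]
  obtain v where v: "v \<in> U" and "r \<in> cline (- 1) (cnj v)"
    using rs(1) \<rho> by blast
  then obtain z where rz: "r = cvec (- z) (z * cnj v)"
    by (auto simp: cline_def)
  \<comment> \<open>The complement is spanned by two roots. If neither lay in
    \<open>span {r, s}\<close>, the dichotomy would make both orthogonal to that plane; the vectors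
    \<open>x\<close> and \<open>y\<close> rule this out.\<close>
  have meets: "\<exists>t. t \<noteq> 0 \<and> t \<in> cline (- cnj q) (cnj p) \<and> t \<in> span {r, s}"
    if arr: "cline p q \<in> subspace_arrangement W" and pq: "p \<noteq> 0 \<or> q \<noteq> 0"
      and x: "x \<in> cline (- cnj q) (cnj p)" and y: "y \<in> span {r, s}" and xy: "x \<bullet> y \<noteq> 0"
    for p q x y
  proof (rule ccontr)
    assume no: "\<not> ?thesis"
    obtain t1 t2 where t: "t1 \<in> roots W" "t2 \<in> roots W"
      and P: "cline (- cnj q) (cnj p) = span {t1, t2}"
      using plane_roots[OF W arr pq] .
    have "t1 \<notin> span {r, s}" "t2 \<notin> span {r, s}"
      using no t nz by (auto simp: P intro: span_base)
    then have "orthogonal x y" if "x \<in> {t1, t2}" "y \<in> {r, s}" for x y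
      using that dichotomy t by (auto simp: orthogonal_def)
    then have "orthogonal x y" if "x \<in> {t1, t2}" for x
      using orthogonal_to_span[OF y] that by blast
    then have "orthogonal y x"
      using orthogonal_to_span[of x "{t1, t2}" y] x unfolding P orthogonal_commute[of y] by blast
    with xy show False by (simp add: orthogonal_def inner_commute)
  qed
  have r_span: "r \<in> span {r, s}" by (simp add: span_base)
  have vz: "z \<noteq> 0" "v \<noteq> 0"
    using nz[OF r] rz v zero by auto
  obtain b where b: "b \<noteq> 0" "cvec 0 b \<in> span {r, s}"
  proof -
    \<comment> \<open>The witness is the second complex coordinate of \<open>r\<close>; since
      \<open>r\<close> lies on a line off the axes, each of its coordinates is nonzero.\<close>
    have "cvec 0 (z * cnj v) \<bullet> r > 0"
      unfolding rz inner_cvec using Re_mult_cnj_pos[of "z * cnj v"] vz by simp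
    then have "\<exists>t. t \<noteq> 0 \<and> t \<in> cline (- cnj 0) (cnj 1) \<and> t \<in> span {r, s}"
      by (intro meets[OF arr0(1) _ _ r_span, of "cvec 0 (z * cnj v)"]) (auto simp: cline_def)
    then show ?thesis using that by (auto simp: cline_def)
  qed
  obtain a where a: "a \<noteq> 0" "cvec a 0 \<in> span {r, s}"
  proof -
    have "cvec (- z) 0 \<bullet> r > 0"
      unfolding rz inner_cvec using Re_mult_cnj_pos[of "- z"] vz by simp
    then have "\<exists>t. t \<noteq> 0 \<and> t \<in> cline (- cnj 1) (cnj 0) \<and> t \<in> span {r, s}"
      by (intro meets[OF arr0(2) _ _ r_span, of "cvec (- z) 0"]) (auto simp: cline_def)
    then obtain x where "x \<noteq> 0" "cvec (- x) 0 \<in> span {r, s}"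
      by (auto simp: cline_def)
    then show ?thesis using that[of "- x"] by simp
  qed
  have "pairwise orthogonal {cvec a 0, cvec 0 b}"
    by (auto simp: pairwise_insert orthogonal_def inner_cvec)
  then have "independent {cvec a 0, cvec 0 b}"
    using a b by (intro pairwise_orthogonal_independent) auto
  moreover have "dim (span {r, s}) \<le> 2"
    using dim_le_card[of "{r, s}" "{r, s}"] rs(3) by (simp add: span_superset)
  ultimately have Q: "span {r, s} = span {cvec a 0, cvec 0 b}"
    using a b by (intro span_pair_eq) auto
  \<comment> \<open>A vector of \<open>span {r, s}\<close> has coordinates that are real multiples
    of \<open>a\<close> and \<open>b\<close>; on the complement of \<open>cline u 1\<close> their
    quotient is \<open>- cnj u\<close>.\<close>
  have ratio: "\<exists>k::real. cnj u = of_real k * (b / a)" if u: "u \<in> U" for u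
  proof -
    have "cvec (- a) (a * cnj u) \<bullet> cvec a 0 < 0"
      unfolding inner_cvec using Re_mult_cnj_pos[OF a(1)] by simp
    then have "\<exists>t. t \<noteq> 0 \<and> t \<in> cline (- cnj 1) (cnj u) \<and> t \<in> span {r, s}"
      by (intro meets[OF arr[OF u] _ _ a(2), of "cvec (- a) (a * cnj u)"]) (auto simp: cline_def)
    then obtain w where w: "cvec (- w) (w * cnj u) \<in> span {cvec a 0, cvec 0 b}" "w \<noteq> 0"
      unfolding Q by (auto simp: cline_def)
    then obtain x y :: real where "cvec (- w) (w * cnj u) = x *\<^sub>R cvec a 0 + y *\<^sub>R cvec 0 b"
      unfolding span_pair_iff by blast
    then have xy: "- w = of_real x * a" "w * cnj u = of_real y * b"
      unfolding cvec_scaleR cvec_add cvec_eq_iff by (simp_all add: scaleR_conv_of_real)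
    then have "x \<noteq> 0" using w by auto
    moreover have "w = - (of_real x * a)" using xy(1) by (metis minus_minus)
    ultimately have "cnj u = of_real (- y / x) * (b / a)"
      using xy(2) a(1) by (simp add: field_simps) (metis minus_minus)
    then show ?thesis ..
  qed
  \<comment> \<open>The case \<open>u = 1\<close> shows that \<open>b / a\<close> is itself
    real.\<close>
  obtain k where k: "1 = of_real k * (b / a)"
    using ratio[OF one] by auto
  obtain l where l: "cnj u = of_real l * (b / a)"
    using ratio[OF u] by auto
  have "k \<noteq> 0" using k by auto
  then have "b / a = of_real (1 / k)" using k by (simp add: field_simps)
  then have "cnj u \<in> \<real>" unfolding l by (metis Reals_mult Reals_of_real)
  then show ?thesis by (simp add: Reals_cnj_iff)
qed

section \<open>The group \<open>G(m,1,2)\<close>\<close>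

definition diag_map :: "complex \<Rightarrow> complex \<Rightarrow> real^4 \<Rightarrow> real^4" where
  "diag_map p q x = cvec (p * of_R4 x $ 1) (q * of_R4 x $ 2)"

definition anti_map :: "complex \<Rightarrow> complex \<Rightarrow> real^4 \<Rightarrow> real^4" where
  "anti_map p q x = cvec (p * of_R4 x $ 2) (q * of_R4 x $ 1)"

lemma diag_map_cvec [simp]: "diag_map p q (cvec a b) = cvec (p * a) (q * b)"
  by (simp add: diag_map_def)

lemma anti_map_cvec [simp]: "anti_map p q (cvec a b) = cvec (p * b) (q * a)"
  by (simp add: anti_map_def)

lemma cvec_fun_eqI: "(\<And>a b. f (cvec a b) = g (cvec a b)) \<Longrightarrow> f = g"
  by (rule ext) (metis cvec_cases)

lemma realification_diag: "realification (vector [vector [p, 0], vector [0, q]]) = diag_map p q"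
  by (rule cvec_fun_eqI)
     (simp add: realification_def vec_eq_iff forall_4 matrix_vector_mult_def sum_2)

lemma realification_anti: "realification (vector [vector [0, p], vector [q, 0]]) = anti_map p q"
  by (rule cvec_fun_eqI)
     (simp add: realification_def vec_eq_iff forall_4 matrix_vector_mult_def sum_2)

text \<open>Trades exponents below \<open>m\<close> for the condition \<open>z ^ m = 1\<close>,
  whose closure under products and inverses is immediate.\<close>

lemma powers_of_primitive_root:
  assumes "m \<ge> 1"
  shows "(\<lambda>j. exp (2 * of_real pi * \<i> / of_nat m) ^ j) ` {..<m} = {z. z ^ m = 1}"
proof -
  have "exp (2 * of_real pi * \<i> / of_nat m) ^ j = cis (2 * pi * real j / real m)" for j
    by (simp add: cis_conv_exp algebra_simps flip: exp_of_nat_mult)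
  then show ?thesis
    using Complex.bij_betw_roots_unity[of m] assms by (simp add: bij_betw_def)
qed

lemma real_G_eq:
  assumes "m \<ge> 1"
  shows "real_G_m_1_2 m = {diag_map p q | p q. p ^ m = 1 \<and> q ^ m = 1} \<union>
    {anti_map p q | p q. p ^ m = 1 \<and> q ^ m = 1}"
proof -
  define U where "U = {z::complex. z ^ m = 1}"
  have "G_m_1_2 m = {vector [vector [p, 0], vector [0, q]] | p q. p \<in> U \<and> q \<in> U} \<union>
     {vector [vector [0, p], vector [q, 0]] | p q. p \<in> U \<and> q \<in> U}"
    unfolding G_m_1_2_def Let_def U_def powers_of_primitive_root[OF assms, symmetric]
    by (auto; blast)
  moreover have "realification ` {vector [vector [p, 0], vector [0, q]] | p q. p \<in> U \<and> q \<in> U} =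
      {diag_map p q | p q. p \<in> U \<and> q \<in> U}"
    unfolding realification_diag[symmetric] by blast
  moreover have "realification ` {vector [vector [0, p], vector [q, 0]] | p q. p \<in> U \<and> q \<in> U} =
      {anti_map p q | p q. p \<in> U \<and> q \<in> U}"
    unfolding realification_anti[symmetric] by blast
  ultimately show ?thesis
    unfolding real_G_m_1_2_def by (simp add: image_Un U_def)
qed

section \<open>Group structure and generation by rotations\<close>

context
  fixes m :: nat
  assumes m: "m \<ge> 1"
begin

lemma real_G_cases:
  assumes "g \<in> real_G_m_1_2 m"
  obtains p q where "p ^ m = 1" "q ^ m = 1" "g = diag_map p q"
        | p q where "p ^ m = 1" "q ^ m = 1" "g = anti_map p q"
  using assms unfolding real_G_eq[OF m] by blast

lemma diag_map_in_G: "p ^ m = 1 \<Longrightarrow> q ^ m = 1 \<Longrightarrow> diag_map p q \<in> real_G_m_1_2 m"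
  and anti_map_in_G: "p ^ m = 1 \<Longrightarrow> q ^ m = 1 \<Longrightarrow> anti_map p q \<in> real_G_m_1_2 m"
  unfolding real_G_eq[OF m] by blast+

lemma root_of_unity_nonzero: "p ^ m = 1 \<Longrightarrow> p \<noteq> (0::complex)"
  using m by (auto simp: power_0_left)

lemma finite_real_G: "finite (real_G_m_1_2 m)"
proof -
  have fin: "finite {z::complex. z ^ m = 1}"
    using m by (intro finite_roots_unity) auto
  have "real_G_m_1_2 m = (\<lambda>(p, q). diag_map p q) ` ({z. z ^ m = 1} \<times> {z. z ^ m = 1}) \<union>
     (\<lambda>(p, q). anti_map p q) ` ({z. z ^ m = 1} \<times> {z. z ^ m = 1})"
    unfolding real_G_eq[OF m] by auto
  then show ?thesis using fin by simp
qed

lemma real_G_carrier: "real_G_m_1_2 m \<subseteq> carrier GL"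
  using realification_in_orthogonal_group
  by (auto simp: real_G_m_1_2_def carrier_GL orthogonal_group_def orthogonal_transformation_linear
      orthogonal_transformation_bij)

lemma real_G_comp:
  assumes "f \<in> real_G_m_1_2 m" "g \<in> real_G_m_1_2 m"
  shows "f \<circ> g \<in> real_G_m_1_2 m"
proof -
  have eqs: "diag_map p q \<circ> diag_map p' q' = diag_map (p * p') (q * q')"
    "diag_map p q \<circ> anti_map p' q' = anti_map (p * p') (q * q')"
    "anti_map p q \<circ> diag_map p' q' = anti_map (p * q') (q * p')"
    "anti_map p q \<circ> anti_map p' q' = diag_map (p * q') (q * p')" for p q p' q'
    by (rule cvec_fun_eqI; simp)+
  show ?thesis
    using assms
    by (elim real_G_cases)
       (auto simp only: eqs intro!: diag_map_in_G anti_map_in_G, auto simp: power_mult_distrib)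
qed

lemma real_G_inv:
  assumes "f \<in> real_G_m_1_2 m"
  shows "inv\<^bsub>GL\<^esub> f \<in> real_G_m_1_2 m"
proof -
  have "\<exists>g \<in> real_G_m_1_2 m. g \<circ> f = id"
    using assms
  proof (cases rule: real_G_cases)
    case (1 p q)
    then have "diag_map (inverse p) (inverse q) \<circ> f = id"
      using root_of_unity_nonzero by (intro cvec_fun_eqI) (auto simp: field_simps)
    with 1 show ?thesis
      by (intro bexI[of _ "diag_map (inverse p) (inverse q)"] diag_map_in_G) (auto simp: power_inverse)
  next
    case (2 p q)
    then have "anti_map (inverse q) (inverse p) \<circ> f = id"
      using root_of_unity_nonzero by (intro cvec_fun_eqI) (auto simp: field_simps)
    with 2 show ?thesis
      by (intro bexI[of _ "anti_map (inverse q) (inverse p)"] anti_map_in_G) (auto simp: power_inverse)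
  qed
  then obtain g where g: "g \<in> real_G_m_1_2 m" "g \<circ> f = id" by blast
  then have "inv\<^bsub>GL\<^esub> f = g"
    using assms real_G_carrier by (intro inv_GL_eq) auto
  with g show ?thesis by simp
qed

lemma subgroup_real_G: "subgroup (real_G_m_1_2 m) GL"
proof (rule group.subgroupI[OF group_GL])
  show "real_G_m_1_2 m \<noteq> {}"
    using diag_map_in_G[of 1 1] by auto
qed (use real_G_carrier real_G_inv real_G_comp in auto)

lemma is_rotation_iff_dim: "is_rotation g \<longleftrightarrow> dim {x. g x = x} = 2" for g :: "real^4 \<Rightarrow> real^4"
  by (auto simp: is_rotation_def fixed_space_def)

lemma fixed_diag_left: 
  assumes "p \<noteq> 1"
  shows "{x. diag_map p 1 x = x} = cline 0 1"
proof (rule Set.set_eqI)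
  fix x
  from assms show "x \<in> {x. diag_map p 1 x = x} \<longleftrightarrow> x \<in> cline 0 1"
    by (cases x rule: cvec_cases) (auto simp: cline_def)
qed

lemma fixed_diag_right: 
  assumes "q \<noteq> 1"
  shows "{x. diag_map 1 q x = x} = cline 1 0"
proof (rule Set.set_eqI)
  fix x
  from assms show "x \<in> {x. diag_map 1 q x = x} \<longleftrightarrow> x \<in> cline 1 0"
    by (cases x rule: cvec_cases) (auto simp: cline_def)
qed

text \<open>Entries with product 1 make the antidiagonal matrix an involution; its eigenvector for
  the eigenvalue 1 is \<open>(p, 1)\<close>.\<close>

lemma fixed_anti: 
  assumes "p \<noteq> 0"
  shows "{x. anti_map p (inverse p) x = x} = cline p 1"
proof (rule Set.set_eqI)
  fix x
  from assms show "x \<in> {x. anti_map p (inverse p) x = x} \<longleftrightarrow> x \<in> cline p 1"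
    by (cases x rule: cvec_cases) (auto simp: cline_def field_simps)
qed

lemma rotation_diag_left: "p \<noteq> 1 \<Longrightarrow> is_rotation (diag_map p 1)"
  and rotation_diag_right: "q \<noteq> 1 \<Longrightarrow> is_rotation (diag_map 1 q)"
  and rotation_anti: "p \<noteq> 0 \<Longrightarrow> is_rotation (anti_map p (inverse p))"
  by (simp_all add: is_rotation_iff_dim fixed_diag_left fixed_diag_right fixed_anti dim_cline)

text \<open>A diagonal element is a product of two elements that each change one coordinate, and an
  antidiagonal one is an antidiagonal rotation times such an element.\<close>

lemma rotation_group_real_G: "rotation_group (real_G_m_1_2 m)"
proof -
  let ?R = "{g \<in> real_G_m_1_2 m. is_rotation g}"
  have "diag_map 1 1 = id" by (rule cvec_fun_eqI) simp
  \<comment> \<open>For \<open>p = 1\<close> the map is the identity, which is not a rotation but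
    belongs to every generated subgroup.\<close>
  then have left: "diag_map p 1 \<in> generate GL ?R" and right: "diag_map 1 p \<in> generate GL ?R"
    if "p ^ m = 1" for p
    using that generate.one[of GL ?R] diag_map_in_G rotation_diag_left[of p] rotation_diag_right[of p]
    by (cases "p = 1"; auto intro!: generate.incl)+
  have diag: "diag_map p q \<in> generate GL ?R" if "p ^ m = 1" "q ^ m = 1" for p q
  proof -
    have "diag_map p q = diag_map p 1 \<circ> diag_map 1 q" by (rule cvec_fun_eqI) simp
    then show ?thesis using generate.eng[OF left right] that by simp
  qed
  have anti: "anti_map p q \<in> generate GL ?R" if "p ^ m = 1" "q ^ m = 1" for p q
  proof -
    have "p \<noteq> 0" using root_of_unity_nonzero that by blast
    then have "anti_map p q = anti_map p (inverse p) \<circ> diag_map (q * p) 1"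
      by (intro cvec_fun_eqI) (simp add: field_simps)
    moreover have "anti_map p (inverse p) \<in> generate GL ?R"
      using that \<open>p \<noteq> 0\<close> anti_map_in_G rotation_anti
      by (intro generate.incl) (auto simp: power_inverse)
    moreover have "diag_map (q * p) 1 \<in> generate GL ?R"
      using that by (intro left) (simp add: power_mult_distrib)
    ultimately show ?thesis using generate.eng by fastforce
  qed
  have "generate GL ?R \<subseteq> real_G_m_1_2 m"
    by (rule group.generate_subgroup_incl[OF group_GL _ subgroup_real_G]) auto
  moreover have "real_G_m_1_2 m \<subseteq> generate GL ?R"
    using diag anti by (auto elim!: real_G_cases)
  ultimately show ?thesis
    using finite_real_G subgroup_real_G by (auto simp: rotation_group_def finite_linear_group_def)
qed

section \<open>Complex lines in the arrangement of the group\<close>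

text \<open>Nontriviality of the isotropy subgroup comes for free: the trivial group would fix the
  whole space, whereas the line has dimension two.\<close>

lemma arrangementI:
  assumes "cline p q = fixed_space {g \<in> real_G_m_1_2 m. g v = v}" "p \<noteq> 0 \<or> q \<noteq> 0"
  shows "cline p q \<in> subspace_arrangement (real_G_m_1_2 m)"
proof -
  have "{g \<in> real_G_m_1_2 m. g v = v} \<noteq> {id}"
  proof
    assume "{g \<in> real_G_m_1_2 m. g v = v} = {id}"
    then have "cline p q = UNIV" using assms(1) by (simp add: fixed_space_def)
    then show False using dim_cline[OF assms(2)] by simp
  qed
  then show ?thesis
    using assms(1) unfolding subspace_arrangement_def isotropy_subgroup_def by blast
qed

text \<open>Each axis is the fixed space of the stabilizer of its unit vector. Complex linearity
  gives one inclusion, and a diagonal element with the nontrivial entry \<open>w\<close> gives the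
  other.\<close>

lemma cline_axis_arrangement:
  fixes w :: complex
  assumes w: "w ^ m = 1" "w \<noteq> 1"
  shows "cline 1 0 \<in> subspace_arrangement (real_G_m_1_2 m)"
    and "cline 0 1 \<in> subspace_arrangement (real_G_m_1_2 m)"
proof -
  have w': "diag_map 1 w \<in> real_G_m_1_2 m" "diag_map w 1 \<in> real_G_m_1_2 m"
    using w diag_map_in_G by simp_all
  show "cline 1 0 \<in> subspace_arrangement (real_G_m_1_2 m)"
  proof (rule arrangementI)
    have "g x = x" if "g \<in> real_G_m_1_2 m" "g (cvec 1 0) = cvec 1 0" "x \<in> cline 1 0" for g x
      using that by (auto elim!: real_G_cases simp: cline_def)
    moreover have "x \<in> cline 1 0" if "diag_map 1 w x = x" for x
      using that fixed_diag_right[OF w(2)] by auto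
    ultimately show "cline 1 0 = fixed_space {g \<in> real_G_m_1_2 m. g (cvec 1 0) = cvec 1 0}"
      using w'(1) by (auto simp: fixed_space_def)
  qed simp
  show "cline 0 1 \<in> subspace_arrangement (real_G_m_1_2 m)"
  proof (rule arrangementI)
    have "g x = x" if "g \<in> real_G_m_1_2 m" "g (cvec 0 1) = cvec 0 1" "x \<in> cline 0 1" for g x
      using that by (auto elim!: real_G_cases simp: cline_def)
    moreover have "x \<in> cline 0 1" if "diag_map w 1 x = x" for x
      using that fixed_diag_left[OF w(2)] by auto
    ultimately show "cline 0 1 = fixed_space {g \<in> real_G_m_1_2 m. g (cvec 0 1) = cvec 0 1}"
      using w'(2) by (auto simp: fixed_space_def)
  qed simp
qed

text \<open>The stabilizer of \<open>(p, 1)\<close> contains an antidiagonal involution, which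
  already cuts the fixed space down to this line.\<close>

lemma cline_diagonal_arrangement:
  assumes p: "p ^ m = 1"
  shows "cline p 1 \<in> subspace_arrangement (real_G_m_1_2 m)"
proof (rule arrangementI)
  have p0: "p \<noteq> 0" using root_of_unity_nonzero[OF p] .
  have "g x = x" if "g \<in> real_G_m_1_2 m" "g (cvec p 1) = cvec p 1" "x \<in> cline p 1" for g x
    using that p0 by (auto elim!: real_G_cases simp: cline_def)
  moreover have "x \<in> cline p 1" if "anti_map p (inverse p) x = x" for x
    using that fixed_anti[OF p0] by auto
  moreover have "anti_map p (inverse p) \<in> real_G_m_1_2 m"
    using p anti_map_in_G by (simp add: power_inverse)
  moreover have "anti_map p (inverse p) (cvec p 1) = cvec p 1"
    using p0 by simp
  ultimately show "cline p 1 = fixed_space {g \<in> real_G_m_1_2 m. g (cvec p 1) = cvec p 1}"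
    unfolding fixed_space_def by blast
qed simp

end

lemma nonreal_root_of_unity:
  assumes "m \<ge> 3"
  obtains w :: complex where "w ^ m = 1" "w \<notin> \<real>"
proof (rule that)
  have "real m * (2 * pi / real m) = 2 * pi"
    using assms by simp
  then show "cis (2 * pi / real m) ^ m = 1"
    by (simp only: Complex.DeMoivre cis_2pi)
  have "2 * pi / real m < pi"
    using assms pi_gt_zero by (simp add: field_simps)
  then have "sin (2 * pi / real m) > 0"
    using assms by (intro sin_gt_zero) auto
  then show "cis (2 * pi / real m) \<notin> \<real>"
    by (simp add: complex_is_Real_iff)
qed

theorem theorem1:
  shows "\<exists>M::nat. \<forall>m\<ge>M. m \<ge> 1 \<longrightarrow>
    rotation_group (real_G_m_1_2 m) \<and>
    (\<forall>W :: (real^4 \<Rightarrow> real^4) set.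
       W \<subseteq> orthogonal_group \<longrightarrow> reflection_group W \<longrightarrow>
       \<not> subspace_arrangement (real_G_m_1_2 m) \<subseteq> subspace_arrangement W)"
proof -
  obtain N :: nat where
    N: "\<And>S :: (real^4) set. \<lbrakk>finite S; S \<subseteq> sphere 0 1; card S > N\<rbrakk> \<Longrightarrow>
       \<exists>r\<in>S. \<exists>s\<in>S. r \<noteq> s \<and> dist r s < 1 / 2"
    using close_unit_vectors by blast
  \<comment> \<open>In the bound \<open>N + 3\<close>, the summand \<open>N\<close> makes the
    \<open>m\<close>-th roots of unity numerous enough for the pigeonhole, and the 3 makes one of
    them nonreal.\<close>
  have "\<not> subspace_arrangement (real_G_m_1_2 m) \<subseteq> subspace_arrangement W"
    if m: "m \<ge> N + 3" and W: "W \<subseteq> orthogonal_group" "reflection_group W"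
    for m and W :: "(real^4 \<Rightarrow> real^4) set"
  proof
    assume sub: "subspace_arrangement (real_G_m_1_2 m) \<subseteq> subspace_arrangement W"
    obtain w :: complex where w: "w ^ m = 1" "w \<notin> \<real>"
      using nonreal_root_of_unity[of m] m by auto
    then have w1: "w \<noteq> 1" by auto
    have "w \<in> \<real>"
    proof (rule roots_of_unity_real[of W "{z. z ^ m = 1}" N])
      show "finite_reflection_group W"
        using W by (rule reflection_group_locale)
      show "cline 1 0 \<in> subspace_arrangement W" "cline 0 1 \<in> subspace_arrangement W"
        using cline_axis_arrangement[OF _ w(1) w1] sub m by auto
      show "cline u 1 \<in> subspace_arrangement W" if "u \<in> {z. z ^ m = 1}" for u
        using cline_diagonal_arrangement[of m u] that sub m by auto
      show "finite {z::complex. z ^ m = 1}"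
        using m by (intro finite_roots_unity) auto
      show "card {z::complex. z ^ m = 1} > N"
        using m by (subst card_roots_unity_eq) auto
    qed (use N w m in \<open>auto simp: power_0_left\<close>)
    with w show False by blast
  qed
  then show ?thesis
    using rotation_group_real_G by (intro exI[of _ "N + 3"]) auto
qed

end
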